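(* Let $(\mathsf{Seq}(\mathscr{L},\Rightarrow),\vdash)$ be a normal sequent structure and let $T$ be a rule of it that is disjoint from the weakening and exchange rules. Then the following statements are equivalent. (1) Every provable sequent has a $T$-free proof. (2) For every provable sequent $\Gamma\Rightarrow\Delta$ both of the following hold. (2a) If $\Gamma$ is not the empty list, then there exist a rule $R$ and a sequent $\Gamma^R\Rightarrow\Delta^R$ that is deducible, by an application of the rule $R$, from a set of sequents which includes $\Gamma\Rightarrow\Delta$ as one of the premises. If $\Delta$ is not the empty list, then there exist a rule $L$ and a sequent $\Gamma^L\Rightarrow\Delta^L$ that is deducible, by an application of the rule $L$, from a set of sequents which includes $\Gamma\Rightarrow\Delta$ as one of the premises. Furthermore, each of the premises (in these applications of $R$ and $L$) is provable. (2b) If there exists a proof of $\Gamma^R\Rightarrow\Delta^R$, then there exists a $T$-free proof of $\Gamma\Rightarrow\Delta$; similarly, if there exists a proof of $\Gamma^L\Rightarrow\Delta^L$, then there exists a $T$-free proof of $\Gamma\Rightarrow\Delta$.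
   Context: Sequents. For a set $\mathscr{L}$, let $\boldsymbol{FO}(\mathscr{L})$ be the set of finite ordered lists of elements of $\mathscr{L}$, and let $\Rightarrow\,\subseteq\boldsymbol{FO}(\mathscr{L})\times\boldsymbol{FO}(\mathscr{L})$. A sequent is a pair $(\Gamma,\Delta)\in\,\Rightarrow$, written $\Gamma\Rightarrow\Delta$; $\mathsf{Seq}(\mathscr{L},\Rightarrow)$ is the set of all sequents. Rules. A rule is a nonempty set $R\subseteq\mathsf{Seq}(\mathscr{L},\Rightarrow)^n\times\mathsf{Seq}(\mathscr{L},\Rightarrow)$ for some $n\in\mathbb{N}=\{0,1,\ldots\}$. It is axiomatic if $\emptyset\subsetneq R\subseteq\{\emptyset\}\times\mathsf{Seq}(\mathscr{L},\Rightarrow)$, and non-axiomatic otherwise. An element $((S_1,\ldots,S_n),S)\in R$ is an instance (application) of $R$, with premises $S_1,\ldots,S_n$ and conclusion $S$. The weakening rules are WL (from $\Gamma\Rightarrow\Delta$ infer $A,\Gamma\Rightarrow\Delta$) and WR (from $\Gamma\Rightarrow\Delta$ infer $\Gamma\Rightarrow\Delta,A$); the exchange rules are EL (from $\Gamma,A,B,\Pi\Rightarrow\Delta$ infer $\Gamma,B,A,\Pi\Rightarrow\Delta$) and ER (from $\Gamma\Rightarrow\Delta,A,B,\Sigma$ infer $\Gamma\Rightarrow\Delta,B,A,\Sigma$). Normal sequent structure. Let $\mathscr{L}$ be the formula algebra (set of formulas) built inductively over a nonempty set $V$ of variables with a finite set of connectives, equipped with a set of rules, and let $\vdash\,\subseteq\mathcal{P}(\mathsf{Seq}(\mathscr{L},\Rightarrow))\times\mathsf{Seq}(\mathscr{L},\Rightarrow)$.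 The pair $(\mathsf{Seq}(\mathscr{L},\Rightarrow),\vdash)$ is a normal sequent structure if: (i) $p\Rightarrow p$ for all $p\in V$, and $\emptyset\vdash p\Rightarrow p$ for all $p\in V$; (ii) the weakening and exchange rules are included in the set of rules; (iii) $\emptyset\vdash\Gamma\Rightarrow\Delta$ means that $\Gamma\Rightarrow\Delta$ is provable, i.e. has a proof: a finite tree of sequents with root $\Gamma\Rightarrow\Delta$, whose leaves are conclusions of instances of axiomatic rules and in which each other node is the conclusion of an instance of a rule with the children of the node as premises; (iv) if $\Gamma\Rightarrow\Delta$ is provable and $\Gamma,\Delta$ both contain only variables, then some $p\in V$ is common to both lists $\Gamma$ and $\Delta$; (v) if $\Gamma\Rightarrow\Delta$ is provable, then $\Gamma$ is not the empty list or $\Delta$ is not the empty list. The rules $R,L,T$ in the claim are from the set of rules of the structure. A proof is $T$-free if it contains no application of $T$. *)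

theory Defs
  imports Main
begin

datatype ('v, 'c) fm = Var 'v | Conn 'c "('v, 'c) fm list"

inductive_set formulas :: "'v set \<Rightarrow> 'c set \<Rightarrow> ('c \<Rightarrow> nat) \<Rightarrow> ('v, 'c) fm set"
  for V :: "'v set" and C :: "'c set" and ar :: "'c \<Rightarrow> nat"
where
  "p \<in> V \<Longrightarrow> Var p \<in> formulas V C ar"
| "\<lbrakk>c \<in> C; length As = ar c; \<forall>A\<in>set As. A \<in> formulas V C ar\<rbrakk>
    \<Longrightarrow> Conn c As \<in> formulas V C ar"

text \<open>The pair \<open>(\<Gamma>, \<Delta>)\<close> stands for \<open>\<Gamma> \<Rightarrow> \<Delta>\<close>.  The relation \<open>\<Rightarrow>\<close>, which need not
  hold between all pairs of lists, is the set \<open>Seq\<close> of all sequents.  In a rule instance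
  the tuple of premises is a list.\<close>

type_synonym 'a sequent = "'a list \<times> 'a list"
type_synonym 'a rule = "('a sequent list \<times> 'a sequent) set"

definition is_rule :: "'a sequent set \<Rightarrow> 'a rule \<Rightarrow> bool" where
  "is_rule Seq R \<longleftrightarrow> R \<noteq> {} \<and> (\<exists>n. R \<subseteq> {Ss. length Ss = n \<and> set Ss \<subseteq> Seq} \<times> Seq)"

definition axiomatic :: "'a sequent set \<Rightarrow> 'a rule \<Rightarrow> bool" where
  "axiomatic Seq R \<longleftrightarrow> R \<noteq> {} \<and> R \<subseteq> {[]} \<times> Seq"

text \<open>The structural rules have an instance for every sequent of the shape of the premise.
  That they are rules in the sense of \<open>is_rule\<close> therefore says that \<open>Seq\<close> is closed
  under weakening and exchange.\<close>

definition WL :: "'a set \<Rightarrow> 'a sequent set \<Rightarrow> 'a rule" where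
  "WL L Seq = {([(\<Gamma>, \<Delta>)], (A # \<Gamma>, \<Delta>)) | A \<Gamma> \<Delta>. A \<in> L \<and> (\<Gamma>, \<Delta>) \<in> Seq}"

definition WR :: "'a set \<Rightarrow> 'a sequent set \<Rightarrow> 'a rule" where
  "WR L Seq = {([(\<Gamma>, \<Delta>)], (\<Gamma>, \<Delta> @ [A])) | A \<Gamma> \<Delta>. A \<in> L \<and> (\<Gamma>, \<Delta>) \<in> Seq}"

definition EL :: "'a sequent set \<Rightarrow> 'a rule" where
  "EL Seq = {([(\<Gamma> @ [A, B] @ \<Pi>, \<Delta>)], (\<Gamma> @ [B, A] @ \<Pi>, \<Delta>)) | \<Gamma> A B \<Pi> \<Delta>.
     (\<Gamma> @ [A, B] @ \<Pi>, \<Delta>) \<in> Seq}"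

definition ER :: "'a sequent set \<Rightarrow> 'a rule" where
  "ER Seq = {([(\<Gamma>, \<Delta> @ [A, B] @ \<Sigma>)], (\<Gamma>, \<Delta> @ [B, A] @ \<Sigma>)) | \<Gamma> \<Delta> A B \<Sigma>.
     (\<Gamma>, \<Delta> @ [A, B] @ \<Sigma>) \<in> Seq}"

datatype 'a ptree = Node (root: 'a) (children: "'a ptree list")

fun is_proof :: "'a sequent set \<Rightarrow> 'a rule set \<Rightarrow> 'a sequent ptree \<Rightarrow> bool" where
  "is_proof Seq Rs (Node S ts) \<longleftrightarrow>
     (if ts = [] then \<exists>R\<in>Rs. axiomatic Seq R \<and> ([], S) \<in> R
      else \<exists>R\<in>Rs. (map root ts, S) \<in> R)
     \<and> (\<forall>t\<in>set ts. is_proof Seq Rs t)"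

fun steps :: "'a sequent ptree \<Rightarrow> ('a sequent list \<times> 'a sequent) set" where
  "steps (Node S ts) = insert (map root ts, S) (\<Union>t\<in>set ts. steps t)"

text \<open>Nodes are not labelled with rules: a step that is an element of \<open>T\<close> is an
  application of \<open>T\<close>, even if it is an element of another rule as well.\<close>

definition rule_free :: "'a rule \<Rightarrow> 'a sequent ptree \<Rightarrow> bool" where
  "rule_free T t \<longleftrightarrow> steps t \<inter> T = {}"

definition provable :: "'a sequent set \<Rightarrow> 'a rule set \<Rightarrow> 'a sequent \<Rightarrow> bool" where
  "provable Seq Rs S \<longleftrightarrow> (\<exists>t. is_proof Seq Rs t \<and> root t = S)"

definition provable_without ::
    "'a rule \<Rightarrow> 'a sequent set \<Rightarrow> 'a rule set \<Rightarrow> 'a sequent \<Rightarrow> bool" where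
  "provable_without T Seq Rs S \<longleftrightarrow> (\<exists>t. is_proof Seq Rs t \<and> root t = S \<and> rule_free T t)"

locale normal_sequent_structure =
  fixes V :: "'v set"
    and C :: "'c set"
    and ar :: "'c \<Rightarrow> nat"
    and Seq :: "('v, 'c) fm sequent set"
    and Rs :: "('v, 'c) fm rule set"
    and entails :: "(('v, 'c) fm sequent set \<times> ('v, 'c) fm sequent) set"
  assumes V_nonempty: "V \<noteq> {}"
    and C_finite: "finite C"
    and Seq_lists: "Seq \<subseteq> lists (formulas V C ar) \<times> lists (formulas V C ar)"
    and rules: "\<And>R. R \<in> Rs \<Longrightarrow> is_rule Seq R"
    and entails_sub: "entails \<subseteq> Pow Seq \<times> Seq"
    and var_sequent: "\<And>p. p \<in> V \<Longrightarrow> ([Var p], [Var p]) \<in> Seq"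
    and var_entailed: "\<And>p. p \<in> V \<Longrightarrow> ({}, ([Var p], [Var p])) \<in> entails"
    and structural:
      "{WL (formulas V C ar) Seq, WR (formulas V C ar) Seq, EL Seq, ER Seq} \<subseteq> Rs"
    and entailed_iff_provable:
      "\<And>\<Gamma> \<Delta>. (\<Gamma>, \<Delta>) \<in> Seq \<Longrightarrow> ({}, (\<Gamma>, \<Delta>)) \<in> entails \<longleftrightarrow> provable Seq Rs (\<Gamma>, \<Delta>)"
    and common_var:
      "\<And>\<Gamma> \<Delta>. \<lbrakk>provable Seq Rs (\<Gamma>, \<Delta>); set \<Gamma> \<subseteq> Var ` V; set \<Delta> \<subseteq> Var ` V\<rbrakk>
        \<Longrightarrow> \<exists>p\<in>V. Var p \<in> set \<Gamma> \<and> Var p \<in> set \<Delta>"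
    and not_both_empty:
      "\<And>\<Gamma> \<Delta>. provable Seq Rs (\<Gamma>, \<Delta>) \<Longrightarrow> \<Gamma> \<noteq> [] \<or> \<Delta> \<noteq> []"

end

theory Submission
  imports Defs
begin

text \<open>The equivalence holds because a rule instance whose premises are all provable has a
  provable conclusion.  In condition (2) every premise of the chosen instance is provable, so
  the antecedent of (2b) is always satisfied (\<open>provable_by_rule\<close>), and (2b) simply asserts
  that \<open>\<Gamma> \<Rightarrow> \<Delta>\<close> has a proof free of \<open>T\<close>.  One of the two cases of (2) applies to every
  provable sequent, since a normal structure does not prove the empty sequent.

  Conversely, given (1), the only thing to find is an instance that has \<open>\<Gamma> \<Rightarrow> \<Delta>\<close> as a
  premise and nothing unprovable beside it.  Weakening by a variable is one
  (\<open>provable_is_premise\<close>): it is available for every sequent and has no further premise.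
  Weakening on the left serves for \<open>R\<close> and for \<open>L\<close> alike, as (2) does not tie either of
  them to a side of the sequent.\<close>

text \<open>Proofs of the premises are the immediate subtrees of a proof of the conclusion.  The
  list of premises has to be nonempty because a leaf is justified by an axiomatic rule,
  whereas the inner nodes may use any rule.\<close>

lemma provable_by_rule:
  assumes "R \<in> Rs" and "(Ss, S) \<in> R" and "Ss \<noteq> []"
    and "\<forall>S'\<in>set Ss. provable Seq Rs S'"
  shows "provable Seq Rs S"
proof -
  obtain f where f: "\<And>S'. S' \<in> set Ss \<Longrightarrow> is_proof Seq Rs (f S') \<and> root (f S') = S'"
    using assms(4) unfolding provable_def by metis
  have "map root (map f Ss) = Ss"
    using f by (simp add: map_idI)
  with assms(1-3) f have "is_proof Seq Rs (Node S (map f Ss))"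
    by auto
  then show ?thesis
    unfolding provable_def by (metis ptree.sel(1))
qed

lemma (in normal_sequent_structure) provable_is_premise:
  assumes "S \<in> Seq" and "provable Seq Rs S"
  shows "\<exists>R\<in>Rs. \<exists>Ss S'. (Ss, S') \<in> R \<and> S \<in> set Ss \<and> (\<forall>P\<in>set Ss. provable Seq Rs P)"
proof -
  obtain p where "p \<in> V"
    using V_nonempty by blast
  then have "Var p \<in> formulas V C ar"
    by (rule formulas.intros)
  then have "([S], (Var p # fst S, snd S)) \<in> WL (formulas V C ar) Seq"
    using assms(1) unfolding WL_def by (cases S) auto
  moreover have "WL (formulas V C ar) Seq \<in> Rs"
    using structural by blast
  ultimately show ?thesis
    using assms(2) by (metis empty_iff empty_set set_ConsD list.set_intros(1))
qed

theorem theorem3p8: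
  fixes V :: "'v set"
    and C :: "'c set"
    and ar :: "'c \<Rightarrow> nat"
    and Seq :: "('v, 'c) fm sequent set"
    and Rs :: "('v, 'c) fm rule set"
    and entails :: "(('v, 'c) fm sequent set \<times> ('v, 'c) fm sequent) set"
    and T :: "('v, 'c) fm rule"
  assumes "normal_sequent_structure V C ar Seq Rs entails"
    and "T \<in> Rs"
    and "T \<inter> (WL (formulas V C ar) Seq \<union> WR (formulas V C ar) Seq \<union> EL Seq \<union> ER Seq) = {}"
  shows "(\<forall>\<Gamma> \<Delta>. (\<Gamma>, \<Delta>) \<in> Seq \<longrightarrow> provable Seq Rs (\<Gamma>, \<Delta>) \<longrightarrow>
            provable_without T Seq Rs (\<Gamma>, \<Delta>))
     \<longleftrightarrow> (\<forall>\<Gamma> \<Delta>. (\<Gamma>, \<Delta>) \<in> Seq \<longrightarrow> provable Seq Rs (\<Gamma>, \<Delta>) \<longrightarrow>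
            (\<Gamma> \<noteq> [] \<longrightarrow>
               (\<exists>R\<in>Rs. \<exists>Ss \<Gamma>R \<Delta>R.
                  (Ss, (\<Gamma>R, \<Delta>R)) \<in> R \<and> (\<Gamma>, \<Delta>) \<in> set Ss
                  \<and> (\<forall>S\<in>set Ss. provable Seq Rs S)
                  \<and> (provable Seq Rs (\<Gamma>R, \<Delta>R) \<longrightarrow> provable_without T Seq Rs (\<Gamma>, \<Delta>))))
          \<and> (\<Delta> \<noteq> [] \<longrightarrow>
               (\<exists>L\<in>Rs. \<exists>Ss \<Gamma>L \<Delta>L.
                  (Ss, (\<Gamma>L, \<Delta>L)) \<in> L \<and> (\<Gamma>, \<Delta>) \<in> set Ss
                  \<and> (\<forall>S\<in>set Ss. provable Seq Rs S)
                  \<and> (provable Seq Rs (\<Gamma>L, \<Delta>L) \<longrightarrow> provable_without T Seq Rs (\<Gamma>, \<Delta>)))))"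
  (is "?one \<longleftrightarrow> ?two")
proof -
  interpret normal_sequent_structure V C ar Seq Rs entails
    by fact
  show ?thesis
  proof
    assume one: ?one
    have "\<exists>R\<in>Rs. \<exists>Ss \<Gamma>' \<Delta>'. (Ss, (\<Gamma>', \<Delta>')) \<in> R \<and> (\<Gamma>, \<Delta>) \<in> set Ss
        \<and> (\<forall>S\<in>set Ss. provable Seq Rs S)
        \<and> (provable Seq Rs (\<Gamma>', \<Delta>') \<longrightarrow> provable_without T Seq Rs (\<Gamma>, \<Delta>))"
      if "(\<Gamma>, \<Delta>) \<in> Seq" "provable Seq Rs (\<Gamma>, \<Delta>)" for \<Gamma> \<Delta>
      using provable_is_premise[OF that] one that by (metis surj_pair)
    then show ?two
      by simp
  next
    assume two: ?two
    show ?one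
    proof (intro allI impI)
      fix \<Gamma> \<Delta>
      assume S: "(\<Gamma>, \<Delta>) \<in> Seq" "provable Seq Rs (\<Gamma>, \<Delta>)"
      then obtain R Ss \<Gamma>' \<Delta>' where inst: "R \<in> Rs" "(Ss, (\<Gamma>', \<Delta>')) \<in> R" "(\<Gamma>, \<Delta>) \<in> set Ss"
          "\<forall>S\<in>set Ss. provable Seq Rs S"
        and free: "provable Seq Rs (\<Gamma>', \<Delta>') \<Longrightarrow> provable_without T Seq Rs (\<Gamma>, \<Delta>)"
        using two not_both_empty[OF S(2)] by meson
      have "Ss \<noteq> []"
        using inst(3) by auto
      from free[OF provable_by_rule[OF inst(1,2) this inst(4)]]
      show "provable_without T Seq Rs (\<Gamma>, \<Delta>)" .
    qed
  qed
qed

end
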